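(* Fix integers $h\ge2$ and $g\ge1$, let $F\subset\{1,\dots,M\}$ be a finite set that is a $B_{h-1}$ set and not a $B_h[g]$ set, and let $B>hM$ be an integer. For $N\ge1$ put $$A_N=\{aB^k+B^{N+k}:a\in F,\ 0\le k<N\}\subset\mathbb Z,$$ so that $\lvert A_N\rvert=\lvert F\rvert N$. Then $$\lvert A_N\rvert-b_{h,g}(A_N)=\Bigl(1-\frac{b_{h,g}(F)}{\lvert F\rvert}\Bigr)\lvert A_N\rvert\qquad\text{and}\qquad \mathcal R^{[g]}_{1/h,h}(A_N)=\frac{\mathcal R^{[g]}_{1/h,h}(F)}{\lvert F\rvert}\,\lvert A_N\rvert .$$ In particular both $\lvert A_N\rvert-b_{h,g}(A_N)$ and $\mathcal R^{[g]}_{1/h,h}(A_N)/(2-2^{1/h})$ are $\asymp_{h,g,F}\lvert A_N\rvert$, so in the inequality $\lvert A\rvert-b_{h,g}(A)\le\mathcal R^{[g]}_{1/h,h}(A)/(2-2^{1/h})$ (valid for all finite subsets $A$ of abelian groups) the linear dependence cannot be improved to any smaller power of $\mathcal R^{[g]}_{1/h,h}(A)$.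
   Context: For a finite subset $A$ of an abelian group, $\mathcal U_h(A)$ is the set of multisets of size $h$ with elements in $A$; $s(u)$ is the sum of $u$ counted with multiplicity; $\nu_u$ is the number of ordered $h$-tuples realizing the multiset $u$. For integers $k,g\ge1$, a set $S$ is a $B_k[g]$ set if every group element equals $s(u)$ for at most $g$ multisets $u\in\mathcal U_k(S)$; a $B_k$ set is a $B_k[1]$ set (every set is $B_1$). $b_{h,g}(A)$ is the largest size of a $B_h[g]$ subset of $A$. For $\alpha>0$, $\alpha\neq1$, $$\mathcal R^{[g]}_{\alpha,h}(A)=\inf_{\chi:\mathcal U_h(A)\to\{1,\dots,g\}}\Bigl\lvert\sum_{u\in\mathcal U_h(A)}\nu_u^\alpha-\sum_{(z,c)}\Bigl(\sum_{u:\,s(u)=z,\ \chi(u)=c}\nu_u\Bigr)^{\alpha}\Bigr\rvert.$$ *)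

theory Defs
  imports Complex_Main "HOL-Library.FuncSet" "HOL-Combinatorics.Multiset_Permutations"
begin

definition msets :: "nat \<Rightarrow> 'a set \<Rightarrow> 'a multiset set" where
  "msets h A = {u. set_mset u \<subseteq> A \<and> size u = h}"

definition nu :: "'a multiset \<Rightarrow> real" where
  "nu u = real (card (permutations_of_multiset u))"

(* The finiteness conjunct only matters for infinite S, where card alone would
   return 0 on infinite fibres. *)
definition is_Bset :: "nat \<Rightarrow> nat \<Rightarrow> 'a::ab_group_add set \<Rightarrow> bool" where
  "is_Bset k g S \<longleftrightarrow>
     (\<forall>z. finite {u \<in> msets k S. sum_mset u = z} \<and> card {u \<in> msets k S. sum_mset u = z} \<le> g)"

definition bmax :: "nat \<Rightarrow> nat \<Rightarrow> 'a::ab_group_add set \<Rightarrow> nat" where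
  "bmax h g A = Max {card S | S. S \<subseteq> A \<and> is_Bset h g S}"

(* Pairs (z, c) whose fibre is empty contribute 0 powr alpha = 0, so it suffices to let z
   range over the attained sums. For finite A and g > 0 the infimum is over a finite nonempty
   set of nonnegative reals. *)
definition rdef :: "real \<Rightarrow> nat \<Rightarrow> nat \<Rightarrow> 'a::ab_group_add set \<Rightarrow> real" where
  "rdef \<alpha> h g A =
     (INF \<chi> \<in> msets h A \<rightarrow>\<^sub>E {1..g}.
        \<bar>(\<Sum>u \<in> msets h A. nu u powr \<alpha>)
         - (\<Sum>(z, c) \<in> sum_mset ` msets h A \<times> {1..g}.
              (\<Sum>u \<in> {u \<in> msets h A. sum_mset u = z \<and> \<chi> u = c}. nu u) powr \<alpha>)\<bar>)"

definition dilates :: "int set \<Rightarrow> int \<Rightarrow> nat \<Rightarrow> int set" where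
  "dilates F B N = {a * B ^ k + B ^ (N + k) | a k. a \<in> F \<and> k < N}"

end

theory Submission
  imports Defs
begin

text \<open>
  Split the multisets of size \<open>h\<close> into fibres of equal sum and equal colour. For \<open>0 \<le> \<alpha> < 1\<close> a fibre
  with \<open>m\<close> members contributes at least \<open>(2 - 2 powr \<alpha>) (m - 1)\<close> to the defect: adding a summand
  \<open>y \<ge> 1\<close> to \<open>x \<ge> 1\<close> loses \<open>x powr \<alpha> + y powr \<alpha> - (x + y) powr \<alpha>\<close>, which increases in both
  variables. Deleting from \<open>A\<close> one element of every multiset but one in each fibre leaves a
  \<open>B_h[g]\<close> set, which bounds \<open>|A| - b_{h,g}(A)\<close> by the defect.

  In \<open>A_N\<close>, the base \<open>B\<close> digits of a sum of \<open>h\<close> elements give, for each layer \<open>k\<close>, the sum and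
  the size of the part of the multiset lying in that layer. If no part has size \<open>h\<close>, then the
  \<open>B_{h-1}\<close> property of \<open>F\<close> recovers the whole multiset. Hence the only nontrivial coincidences
  of sums are \<open>N\<close> disjoint copies of those of \<open>F\<close>, and both quantities get multiplied by \<open>N\<close>.
\<close>

section \<open>The defect of a colouring\<close>

lemma powr_gap_mono:
  fixes x x' y \<alpha> :: real
  assumes "0 \<le> \<alpha>" "\<alpha> \<le> 1" "0 < x" "x \<le> x'" "0 \<le> y"
  shows "x powr \<alpha> + y powr \<alpha> - (x + y) powr \<alpha> \<le> x' powr \<alpha> + y powr \<alpha> - (x' + y) powr \<alpha>"
proof (rule DERIV_nonneg_imp_nondecreasing[OF assms(4)], intro exI conjI)
  fix t assume t: "x \<le> t" "t \<le> x'"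
  show "((\<lambda>t. t powr \<alpha> + y powr \<alpha> - (t + y) powr \<alpha>) has_real_derivative
      \<alpha> * t powr (\<alpha> - 1) - \<alpha> * (t + y) powr (\<alpha> - 1)) (at t)"
    using t assms by (auto intro!: derivative_eq_intros)
  \<comment> \<open>The exponent \<open>\<alpha> - 1\<close> is nonpositive and \<open>t\<close> is
    positive, so a larger base gives a smaller power; this makes the derivative nonnegative.\<close>
  have "(t + y) powr (\<alpha> - 1) \<le> t powr (\<alpha> - 1)"
    using t assms by (intro powr_mono2') auto
  then show "0 \<le> \<alpha> * t powr (\<alpha> - 1) - \<alpha> * (t + y) powr (\<alpha> - 1)"
    using assms(1) by (simp add: mult_left_mono)
qed

text \<open>At \<open>x = y = 1\<close> the right side equals \<open>2 - 2 powr \<alpha>\<close>.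
  One use of monotonicity raises the first variable from 1 to \<open>x\<close>; after swapping roles
  a second use raises the other from 1 to \<open>y\<close>.\<close>

lemma powr_gap_ge:
  fixes x y \<alpha> :: real
  assumes "0 \<le> \<alpha>" "\<alpha> \<le> 1" "1 \<le> x" "1 \<le> y"
  shows "2 - 2 powr \<alpha> \<le> x powr \<alpha> + y powr \<alpha> - (x + y) powr \<alpha>"
proof -
  have "1 powr \<alpha> + 1 powr \<alpha> - (1 + 1) powr \<alpha> \<le> x powr \<alpha> + 1 powr \<alpha> - (x + 1) powr \<alpha>"
    using assms by (intro powr_gap_mono) auto
  moreover have "1 powr \<alpha> + x powr \<alpha> - (1 + x) powr \<alpha> \<le> y powr \<alpha> + x powr \<alpha> - (y + x) powr \<alpha>"
    using assms by (intro powr_gap_mono) auto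
  ultimately show ?thesis by (simp add: add.commute)
qed

text \<open>The members are merged one at a time. Each of the \<open>card C - 1\<close> merges joins
  a value of at least 1 to a partial sum of at least 1, so \<open>powr_gap_ge\<close> charges each
  of them \<open>2 - 2 powr \<alpha>\<close>.\<close>

lemma sum_powr_gap_ge:
  fixes f :: "'a \<Rightarrow> real" and \<alpha> :: real
  assumes "0 \<le> \<alpha>" "\<alpha> \<le> 1" "finite C" "C \<noteq> {}" "\<And>u. u \<in> C \<Longrightarrow> 1 \<le> f u"
  shows "(2 - 2 powr \<alpha>) * (real (card C) - 1) \<le> (\<Sum>u\<in>C. f u powr \<alpha>) - sum f C powr \<alpha>"
  using assms(3,4,5)
proof (induction rule: finite_ne_induct)
  case (insert x C)
  obtain y where "y \<in> C" using insert.hyps by auto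
  then have "1 \<le> sum f C"
    using insert.prems member_le_sum[of y C f] insert.hyps by force
  then have "2 - 2 powr \<alpha> \<le> f x powr \<alpha> + sum f C powr \<alpha> - (f x + sum f C) powr \<alpha>"
    using insert.prems assms by (intro powr_gap_ge) auto
  moreover have "(2 - 2 powr \<alpha>) * (real (card C) - 1) \<le> (\<Sum>u\<in>C. f u powr \<alpha>) - sum f C powr \<alpha>"
    using insert by auto
  ultimately show ?case
    using insert.hyps by (simp add: algebra_simps)
qed simp

section \<open>Orderings of multisets, and fibres of equal sum and colour\<close>

lemma nu_ge_1: "1 \<le> nu u"
proof -
  have "card (permutations_of_multiset u) \<noteq> 0"
    by (simp add: card_eq_0_iff)
  then show ?thesis by (simp add: nu_def Suc_le_eq card_gt_0_iff)
qed

lemma nu_image_mset: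
  assumes "inj f"
  shows "nu (image_mset f u) = nu u"
  unfolding nu_def permutations_of_multiset_image
  using assms by (simp add: card_image inj_on_subset[OF inj_mapI])

lemma finite_msets: "finite A \<Longrightarrow> finite (msets h A)"
  using finite_multisets_of_size[of A h] by (simp add: msets_def multisets_of_size_def)

text \<open>Taken as an image over the members of \<open>U\<close>, so that every fibre is nonempty
  and the number of colours does not enter.\<close>

definition fibres :: "('a::ab_group_add multiset \<Rightarrow> nat) \<Rightarrow> 'a multiset set \<Rightarrow> 'a multiset set set" where
  "fibres \<chi> U = (\<lambda>u. {v \<in> U. sum_mset v = sum_mset u \<and> \<chi> v = \<chi> u}) ` U"

definition gap :: "real \<Rightarrow> 'a multiset set \<Rightarrow> real" where
  "gap \<alpha> C = (\<Sum>u\<in>C. nu u powr \<alpha>) - sum nu C powr \<alpha>"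

text \<open>This is the quantity inside the absolute value of \<open>rdef\<close>, regrouped by
  fibres. Allowing an arbitrary set \<open>U\<close> of multisets makes it possible to cut the
  defect into pieces.\<close>

definition defect :: "real \<Rightarrow> ('a::ab_group_add multiset \<Rightarrow> nat) \<Rightarrow> 'a multiset set \<Rightarrow> real" where
  "defect \<alpha> \<chi> U = (\<Sum>C\<in>fibres \<chi> U. gap \<alpha> C)"

lemma fibres_props:
  assumes "finite U"
  shows "finite (fibres \<chi> U)" "C \<in> fibres \<chi> U \<Longrightarrow> finite C"
    "C \<in> fibres \<chi> U \<Longrightarrow> C \<noteq> {}" "pairwise disjnt (fibres \<chi> U)" "\<Union>(fibres \<chi> U) = U"
  using assms by (auto simp: fibres_def pairwise_def disjnt_def)

lemma sum_fibres:
  assumes "finite U"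
  shows "(\<Sum>C\<in>fibres \<chi> U. sum f C) = sum f U"
proof -
  note F = fibres_props[OF assms, where \<chi> = \<chi>]
  have "sum f (\<Union>(fibres \<chi> U)) = (sum \<circ> sum) f (fibres \<chi> U)"
    using F(2,4) by (intro sum.Union_disjoint) (auto simp: pairwise_def disjnt_def)
  then show ?thesis using F(5) by simp
qed

text \<open>Pairs with an empty fibre contribute \<open>0 powr \<alpha> = 0\<close>, and a nonempty
  fibre belongs to exactly one pair, so the sum over pairs turns into a sum over
  \<open>fibres\<close>.\<close>

lemma defect_eq:
  assumes "finite U" "\<chi> \<in> U \<rightarrow> {1..g}"
  shows "defect \<alpha> \<chi> U = (\<Sum>u\<in>U. nu u powr \<alpha>)
    - (\<Sum>(z, c)\<in>sum_mset ` U \<times> {1..g}. (\<Sum>u\<in>{u \<in> U. sum_mset u = z \<and> \<chi> u = c}. nu u) powr \<alpha>)"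
proof -
  define K where "K = (\<lambda>u. (sum_mset u, \<chi> u)) ` U"
  define fib where "fib = (\<lambda>(z, c). {u \<in> U. sum_mset u = z \<and> \<chi> u = c})"
  have "(\<Sum>(z, c)\<in>sum_mset ` U \<times> {1..g}. (\<Sum>u\<in>{u \<in> U. sum_mset u = z \<and> \<chi> u = c}. nu u) powr \<alpha>)
     = (\<Sum>p\<in>sum_mset ` U \<times> {1..g}. sum nu (fib p) powr \<alpha>)"
    by (simp add: fib_def case_prod_unfold)
  also have "\<dots> = (\<Sum>p\<in>K. sum nu (fib p) powr \<alpha>)"
  proof (rule sum.mono_neutral_right)
    show "\<forall>p\<in>sum_mset ` U \<times> {1..g} - K. sum nu (fib p) powr \<alpha> = 0"
    proof
      fix p assume "p \<in> sum_mset ` U \<times> {1..g} - K"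
      then have "fib p = {}" by (auto simp: fib_def K_def image_iff split: prod.splits)
      then show "sum nu (fib p) powr \<alpha> = 0" by simp
    qed
  qed (use assms in \<open>auto simp: K_def\<close>)
  also have "\<dots> = (\<Sum>C\<in>fib ` K. sum nu C powr \<alpha>)"
  proof (rule sum.reindex_cong[symmetric, OF _ refl refl, of fib])
    show "inj_on fib K"
    proof (rule inj_onI)
      fix p q assume pq: "p \<in> K" "q \<in> K" "fib p = fib q"
      from pq(1) obtain u where u: "u \<in> U" "p = (sum_mset u, \<chi> u)" by (auto simp: K_def)
      then have "u \<in> fib q" using pq(3) by (auto simp: fib_def)
      then show "p = q" using u by (auto simp: fib_def split: prod.splits)
    qed
  qed
  also have "fib ` K = fibres \<chi> U"
    by (simp add: fibres_def fib_def K_def image_image)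
  finally show ?thesis
    unfolding defect_def gap_def sum_subtractf sum_fibres[OF assms(1)] by simp
qed

text \<open>Since the fibres partition \<open>U\<close>, the difference of cardinalities is the sum
  of \<open>card C - 1\<close> over all fibres \<open>C\<close>; \<open>sum_powr_gap_ge\<close>
  applies to each of them because every \<open>nu u\<close> is at least 1.\<close>

lemma defect_ge:
  assumes "finite U" "0 \<le> \<alpha>" "\<alpha> \<le> 1"
  shows "(2 - 2 powr \<alpha>) * (real (card U) - real (card (fibres \<chi> U))) \<le> defect \<alpha> \<chi> U"
proof -
  note F = fibres_props[OF assms(1), where \<chi> = \<chi>]
  have "real (card U) = (\<Sum>C\<in>fibres \<chi> U. real (card C))"
    using sum_fibres[OF assms(1), of "\<lambda>_. 1::real" \<chi>] by simp
  then have "(2 - 2 powr \<alpha>) * (real (card U) - real (card (fibres \<chi> U)))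
      = (\<Sum>C\<in>fibres \<chi> U. (2 - 2 powr \<alpha>) * (real (card C) - 1))"
    by (simp add: sum_subtractf flip: sum_distrib_left)
  also have "\<dots> \<le> defect \<alpha> \<chi> U"
    unfolding defect_def gap_def
    by (intro sum_mono sum_powr_gap_ge F(2,3) nu_ge_1 assms(2,3))
  finally show ?thesis .
qed

section \<open>Nonnegativity of the defect and its infimum over colourings\<close>

lemma two_powr_less_2: "\<alpha> < 1 \<Longrightarrow> 2 powr \<alpha> < (2::real)"
  using powr_less_mono[of \<alpha> 1 "2::real"] by simp

lemma two_powr_le_2: "\<alpha> \<le> 1 \<Longrightarrow> 2 powr \<alpha> \<le> (2::real)"
  using powr_mono[of \<alpha> 1 "2::real"] by simp

lemma card_fibres_le: "finite U \<Longrightarrow> card (fibres \<chi> U) \<le> card U"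
  unfolding fibres_def by (rule card_image_le)

lemma defect_nonneg:
  assumes "finite U" "0 \<le> \<alpha>" "\<alpha> \<le> 1"
  shows "0 \<le> defect \<alpha> \<chi> U"
  using defect_ge[OF assms, of \<chi>] two_powr_le_2[OF assms(3)] card_fibres_le[OF assms(1), of \<chi>]
  by (smt (verit) mult_nonneg_nonneg of_nat_le_iff)

text \<open>The absolute value disappears because the defect is nonnegative for exponents in the
  unit interval.\<close>

lemma rdef_eq:
  assumes "finite A" "0 \<le> \<alpha>" "\<alpha> \<le> 1"
  shows "rdef \<alpha> h g A = (INF \<chi> \<in> msets h A \<rightarrow>\<^sub>E {1..g}. defect \<alpha> \<chi> (msets h A))"
  unfolding rdef_def
proof (rule INF_cong[OF refl])
  fix \<chi> assume "\<chi> \<in> msets h A \<rightarrow>\<^sub>E {1..g}"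
  then have "\<chi> \<in> msets h A \<rightarrow> {1..g}" by (auto simp: PiE_def)
  note defect_eq[OF finite_msets[OF assms(1)] this, of \<alpha>, symmetric]
  then show "\<bar>(\<Sum>u \<in> msets h A. nu u powr \<alpha>)
         - (\<Sum>(z, c) \<in> sum_mset ` msets h A \<times> {1..g}.
              (\<Sum>u \<in> {u \<in> msets h A. sum_mset u = z \<and> \<chi> u = c}. nu u) powr \<alpha>)\<bar>
      = defect \<alpha> \<chi> (msets h A)"
    using defect_nonneg[OF finite_msets[OF assms(1)] assms(2,3), of \<chi>] by simp
qed

lemma defect_cong:
  assumes "\<And>u. u \<in> U \<Longrightarrow> \<chi> u = \<chi>' u"
  shows "defect \<alpha> \<chi> U = defect \<alpha> \<chi>' U"
proof -
  have "fibres \<chi> U = fibres \<chi>' U"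
    unfolding fibres_def using assms by (intro image_cong) auto
  then show ?thesis by (simp add: defect_def)
qed

lemma rdef_le_defect:
  assumes "finite A" "0 \<le> \<alpha>" "\<alpha> \<le> 1" "\<chi> \<in> msets h A \<rightarrow> {1..g}"
  shows "rdef \<alpha> h g A \<le> defect \<alpha> \<chi> (msets h A)"
proof -
  have "bdd_below ((\<lambda>\<chi>. defect \<alpha> \<chi> (msets h A)) ` (msets h A \<rightarrow>\<^sub>E {1..g}))"
    using defect_nonneg[OF finite_msets[OF assms(1)] assms(2,3)] by (auto intro!: bdd_belowI)
  \<comment> \<open>The infimum ranges over extensional functions only; restriction changes no value
    on \<open>msets h A\<close>, hence not the defect.\<close>
  moreover have "restrict \<chi> (msets h A) \<in> msets h A \<rightarrow>\<^sub>E {1..g}"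
    using assms(4) by auto
  ultimately have "rdef \<alpha> h g A \<le> defect \<alpha> (restrict \<chi> (msets h A)) (msets h A)"
    unfolding rdef_eq[OF assms(1-3)] by (rule cINF_lower)
  also have "\<dots> = defect \<alpha> \<chi> (msets h A)"
    by (intro defect_cong) simp
  finally show ?thesis .
qed

text \<open>There are finitely many extensional colourings, and \<open>1 \<le> g\<close> guarantees
  at least one, so the infimum is a minimum.\<close>

lemma rdef_attained:
  assumes "finite A" "0 \<le> \<alpha>" "\<alpha> \<le> 1" "1 \<le> g"
  obtains \<chi> where "\<chi> \<in> msets h A \<rightarrow> {1..g}" "rdef \<alpha> h g A = defect \<alpha> \<chi> (msets h A)"
proof -
  let ?X = "(\<lambda>\<chi>. defect \<alpha> \<chi> (msets h A)) ` (msets h A \<rightarrow>\<^sub>E {1..g})"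
  have "finite ?X"
    using finite_msets[OF assms(1)] by (intro finite_imageI finite_PiE) auto
  moreover have "?X \<noteq> {}"
    using assms(4) by (auto simp: PiE_eq_empty_iff)
  ultimately have "Inf ?X \<in> ?X"
    using Min_in cInf_eq_Min by metis
  then show ?thesis
    using that unfolding rdef_eq[OF assms(1-3), symmetric] by (auto simp: PiE_def)
qed

section \<open>Largest \<open>B_h[g]\<close> subsets and the deletion inequality\<close>

lemma bmax_set:
  assumes "finite A"
  shows "finite {card S |S. S \<subseteq> A \<and> is_Bset h g S}"
  using assms by (auto intro: finite_subset[of _ "card ` Pow A"])

lemma bmax_ge:
  assumes "finite A" "S \<subseteq> A" "is_Bset h g S"
  shows "card S \<le> bmax h g A"
  unfolding bmax_def using assms bmax_set by (intro Max_ge) auto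

text \<open>Ensures that the maximum in \<open>bmax\<close> is over a nonempty set. The empty
  multiset occurs when \<open>h = 0\<close>, which is where \<open>1 \<le> g\<close> enters.\<close>

lemma is_Bset_empty: "1 \<le> g \<Longrightarrow> is_Bset h g {}"
proof -
  assume g: "1 \<le> g"
  have sub: "{u \<in> msets h {}. sum_mset u = z} \<subseteq> {{#}}" for z :: 'a
    by (auto simp: msets_def)
  show ?thesis
    unfolding is_Bset_def
  proof (intro allI conjI)
    fix z :: 'a
    show "finite {u \<in> msets h {}. sum_mset u = z}"
      using sub by (rule finite_subset) simp
    show "card {u \<in> msets h {}. sum_mset u = z} \<le> g"
      using card_mono[OF _ sub[of z]] g by simp
  qed
qed

lemma bmax_attained:
  assumes "finite A" "1 \<le> g"
  obtains S where "S \<subseteq> A" "is_Bset h g S" "card S = bmax h g A"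
proof -
  have "bmax h g A \<in> {card S |S. S \<subseteq> A \<and> is_Bset h g S}"
    unfolding bmax_def using is_Bset_empty[OF assms(2)] bmax_set[OF assms(1)]
    by (intro Max_in) auto
  then show ?thesis using that by auto
qed

lemma card_minus_bmax_le_defect:
  fixes A :: "'a::ab_group_add set"
  assumes "finite A" "0 \<le> \<alpha>" "\<alpha> < 1" "0 < h" "\<chi> \<in> msets h A \<rightarrow> {1..g}"
  shows "(2 - 2 powr \<alpha>) * (real (card A) - real (bmax h g A)) \<le> defect \<alpha> \<chi> (msets h A)"
proof -
  define U where "U = msets h A"
  have finU: "finite U" unfolding U_def by (rule finite_msets[OF assms(1)])
  note F = fibres_props[OF finU, where \<chi> = \<chi>]
  define rep :: "'a multiset set \<Rightarrow> 'a multiset" where "rep C = (SOME u. u \<in> C)" for C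
  have rep: "rep C \<in> C" if "C \<in> fibres \<chi> U" for C
    using F(3)[OF that] unfolding rep_def by (simp add: some_in_eq)
  define R where "R = rep ` fibres \<chi> U"
  have RU: "R \<subseteq> U" using rep F(5) unfolding R_def by blast
  \<comment> \<open>A fibre is determined by its sum and colour, so two representatives sharing both
    come from the same fibre.\<close>
  have R_inj: "u = v" if "u \<in> R" "v \<in> R" "sum_mset u = sum_mset v" "\<chi> u = \<chi> v" for u v
  proof -
    obtain C D where CD: "C \<in> fibres \<chi> U" "u = rep C" "D \<in> fibres \<chi> U" "v = rep D"
      using \<open>u \<in> R\<close> \<open>v \<in> R\<close> by (auto simp: R_def)
    obtain a b where "C = {w \<in> U. sum_mset w = sum_mset a \<and> \<chi> w = \<chi> a}"
      "D = {w \<in> U. sum_mset w = sum_mset b \<and> \<chi> w = \<chi> b}"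
      using CD unfolding fibres_def by auto
    moreover have "u \<in> C" "v \<in> D" using rep CD by auto
    ultimately have "C = D" using that by auto
    then show ?thesis using CD by simp
  qed
  have "C = D" if CD: "C \<in> fibres \<chi> U" "D \<in> fibres \<chi> U" "rep C = rep D" for C D
  proof (rule ccontr)
    assume "C \<noteq> D"
    then have "C \<inter> D = {}" using F(4) CD(1,2) by (auto simp: pairwise_def disjnt_def)
    then show False using rep[OF CD(1)] rep[OF CD(2)] CD(3) by auto
  qed
  then have cardR: "card R = card (fibres \<chi> U)"
    unfolding R_def by (intro card_image inj_onI)
  define pick :: "'a multiset \<Rightarrow> 'a" where "pick u = (SOME x. x \<in># u)" for u
  have pick: "pick u \<in># u" if "u \<in> U" for u
  proof -
    have "u \<noteq> {#}" using that assms(4) by (auto simp: U_def msets_def)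
    then show ?thesis unfolding pick_def by (metis multiset_nonemptyE someI)
  qed
  \<comment> \<open>Every multiset outside \<open>R\<close> loses one of its elements, so only
    representatives survive over \<open>S\<close>. The choice of an element is possible because
    \<open>0 < h\<close>.\<close>
  define S where "S = A - pick ` (U - R)"
  have "msets h S \<subseteq> R"
  proof
    fix u assume u: "u \<in> msets h S"
    then have "u \<in> U" by (auto simp: U_def S_def msets_def)
    then show "u \<in> R" using u pick[of u] by (auto simp: S_def msets_def)
  qed
  have "is_Bset h g S"
    unfolding is_Bset_def
  proof (intro allI conjI)
    fix z
    let ?Z = "{u \<in> msets h S. sum_mset u = z}"
    show "finite ?Z"
      using \<open>msets h S \<subseteq> R\<close> RU finU by (auto intro: finite_subset)
    \<comment> \<open>Surviving multisets of equal sum carry distinct colours, and only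
      \<open>g\<close> colours are available.\<close>
    have "inj_on \<chi> ?Z"
    proof (rule inj_onI)
      fix u v assume "u \<in> ?Z" "v \<in> ?Z" "\<chi> u = \<chi> v"
      then show "u = v" using \<open>msets h S \<subseteq> R\<close> by (intro R_inj) auto
    qed
    moreover have "\<chi> ` ?Z \<subseteq> {1..g}"
    proof (rule image_subsetI)
      fix u assume "u \<in> ?Z"
      then have "u \<in> msets h A" using \<open>msets h S \<subseteq> R\<close> RU unfolding U_def by auto
      then show "\<chi> u \<in> {1..g}" using assms(5) by (rule Pi_mem[rotated])
    qed
    ultimately show "card ?Z \<le> g"
      using card_inj_on_le[of \<chi> ?Z "{1..g}"] by simp
  qed
  then have "card S \<le> bmax h g A"
    by (intro bmax_ge assms(1)) (auto simp: S_def)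
  moreover have "card (pick ` (U - R)) \<le> card U - card R"
    using card_image_le[of "U - R" pick] finU RU by (simp add: card_Diff_subset finite_subset)
  moreover have "card A \<le> card S + card (pick ` (U - R))"
    using diff_card_le_card_Diff[of "pick ` (U - R)" A] finU unfolding S_def by simp
  \<comment> \<open>The truncated subtraction in \<open>card U - card R\<close> is exact because
    \<open>R\<close> is contained in \<open>U\<close>.\<close>
  ultimately have "card A + card R \<le> bmax h g A + card U"
    using card_mono[OF finU RU] by linarith
  then have "real (card A) - real (bmax h g A) \<le> real (card U) - real (card (fibres \<chi> U))"
    using cardR by linarith
  then have "(2 - 2 powr \<alpha>) * (real (card A) - real (bmax h g A))
      \<le> (2 - 2 powr \<alpha>) * (real (card U) - real (card (fibres \<chi> U)))"
    using two_powr_less_2[OF assms(3)] by (intro mult_left_mono) auto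
  also have "\<dots> \<le> defect \<alpha> \<chi> U"
    using assms finU by (intro defect_ge) auto
  finally show ?thesis unfolding U_def .
qed

lemma card_minus_bmax_le_rdef:
  fixes A :: "'a::ab_group_add set"
  assumes "finite A" "0 \<le> \<alpha>" "\<alpha> < 1" "0 < h" "1 \<le> g"
  shows "real (card A) - real (bmax h g A) \<le> rdef \<alpha> h g A / (2 - 2 powr \<alpha>)"
proof -
  obtain \<chi> where "\<chi> \<in> msets h A \<rightarrow> {1..g}" "rdef \<alpha> h g A = defect \<alpha> \<chi> (msets h A)"
    using rdef_attained[of A \<alpha> g h] assms by auto
  then show ?thesis
    using card_minus_bmax_le_defect[OF assms(1-4), of \<chi> g] two_powr_less_2[OF assms(3)]
    by (simp add: field_simps)
qed

section \<open>Additivity and transport of the defect\<close>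

lemma fibres_union:
  assumes "sum_mset ` U \<inter> sum_mset ` V = {}"
  shows "fibres \<chi> (U \<union> V) = fibres \<chi> U \<union> fibres \<chi> V"
proof -
  let ?fib = "\<lambda>W u. {v \<in> W. sum_mset v = sum_mset u \<and> \<chi> v = \<chi> u}"
  have ne: "sum_mset u \<noteq> sum_mset v" if "u \<in> U" "v \<in> V" for u v
    using assms that by blast
  have "?fib (U \<union> V) u = ?fib U u" if "u \<in> U" for u
    using ne[OF that] by force
  moreover have "?fib (U \<union> V) u = ?fib V u" if "u \<in> V" for u
    using ne[OF _ that] by force
  ultimately show ?thesis
    unfolding fibres_def image_Un by (metis (no_types, lifting) image_cong)
qed

text \<open>Without a common sum no fibre meets both sets, so the fibres of the union are those of
  \<open>U\<close> together with those of \<open>V\<close>, with no repetition.\<close>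

lemma defect_union:
  assumes "finite U" "finite V" "sum_mset ` U \<inter> sum_mset ` V = {}"
  shows "defect \<alpha> \<chi> (U \<union> V) = defect \<alpha> \<chi> U + defect \<alpha> \<chi> V"
proof -
  have "U \<inter> V = {}" using assms(3) by blast
  have "C \<notin> fibres \<chi> V" if "C \<in> fibres \<chi> U" for C
  proof
    assume "C \<in> fibres \<chi> V"
    then have "C \<subseteq> V" "C \<subseteq> U" "C \<noteq> {}"
      using that fibres_props(5)[OF assms(1), of \<chi>] fibres_props(5)[OF assms(2), of \<chi>]
        fibres_props(3)[OF assms(1) that] by auto
    then show False using \<open>U \<inter> V = {}\<close> by auto
  qed
  then show ?thesis
    unfolding defect_def fibres_union[OF assms(3)]
    using assms by (intro sum.union_disjoint fibres_props(1)) auto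
qed

lemma defect_empty: "defect \<alpha> \<chi> {} = 0"
  by (simp add: defect_def fibres_def)

lemma defect_UN:
  assumes "finite I" "\<And>i. i \<in> I \<Longrightarrow> finite (U i)"
    and "\<And>i j. i \<in> I \<Longrightarrow> j \<in> I \<Longrightarrow> i \<noteq> j \<Longrightarrow> sum_mset ` U i \<inter> sum_mset ` U j = {}"
  shows "defect \<alpha> \<chi> (\<Union>i\<in>I. U i) = (\<Sum>i\<in>I. defect \<alpha> \<chi> (U i))"
  using assms
proof (induction rule: finite_induct)
  case (insert i I)
  have "sum_mset ` U i \<inter> sum_mset ` U j = {}" if "j \<in> I" for j
    using insert.prems(2)[of i j] insert.hyps that by auto
  then have "sum_mset ` U i \<inter> sum_mset ` (\<Union>j\<in>I. U j) = {}"
    unfolding image_UN by blast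
  then have "defect \<alpha> \<chi> (U i \<union> (\<Union>j\<in>I. U j)) = defect \<alpha> \<chi> (U i) + defect \<alpha> \<chi> (\<Union>j\<in>I. U j)"
    using insert.hyps insert.prems(1) by (intro defect_union) auto
  then show ?case using insert by simp
qed (simp add: defect_empty)

text \<open>All fibres are singletons, and a singleton has gap 0.\<close>

lemma defect_inj:
  assumes "inj_on sum_mset U"
  shows "defect \<alpha> \<chi> U = 0"
  unfolding defect_def
proof (rule sum.neutral, rule ballI)
  fix C assume "C \<in> fibres \<chi> U"
  then obtain u where u: "u \<in> U" "C = {v \<in> U. sum_mset v = sum_mset u \<and> \<chi> v = \<chi> u}"
    by (auto simp: fibres_def)
  then have "C = {u}" using assms by (auto dest: inj_onD)
  then show "gap \<alpha> C = 0" by (simp add: gap_def)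
qed

text \<open>The map preserves and reflects equality of sums, so it carries fibres onto fibres, and
  it keeps every \<open>nu\<close>. Later \<open>f\<close> is \<open>image_mset (e k)\<close>, which
  reduces the defect of a layer to that of \<open>F\<close>.\<close>

lemma defect_image:
  assumes inj: "inj_on f U"
    and nu: "\<And>u. u \<in> U \<Longrightarrow> nu (f u) = nu u"
    and sum: "\<And>u v. u \<in> U \<Longrightarrow> v \<in> U \<Longrightarrow> sum_mset (f u) = sum_mset (f v) \<longleftrightarrow> sum_mset u = sum_mset v"
  shows "defect \<alpha> \<chi> (f ` U) = defect \<alpha> (\<chi> \<circ> f) U"
proof -
  have fib: "{v \<in> f ` U. sum_mset v = sum_mset (f u) \<and> \<chi> v = \<chi> (f u)}
      = f ` {v \<in> U. sum_mset v = sum_mset u \<and> (\<chi> \<circ> f) v = (\<chi> \<circ> f) u}" if "u \<in> U" for u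
    using sum that by auto
  have "fibres \<chi> (f ` U) = (\<lambda>C. f ` C) ` fibres (\<chi> \<circ> f) U"
    unfolding fibres_def image_image using fib by (intro image_cong) auto
  moreover have sub: "C \<subseteq> U" if "C \<in> fibres (\<chi> \<circ> f) U" for C
    using that by (auto simp: fibres_def)
  moreover have "inj_on (\<lambda>C. f ` C) (fibres (\<chi> \<circ> f) U)"
    using sub by (intro inj_onI) (simp add: inj_on_image_eq_iff[OF inj])
  ultimately have "defect \<alpha> \<chi> (f ` U) = (\<Sum>C\<in>fibres (\<chi> \<circ> f) U. gap \<alpha> (f ` C))"
    by (simp add: defect_def sum.reindex)
  also have "\<dots> = defect \<alpha> (\<chi> \<circ> f) U"
    unfolding defect_def
  proof (rule sum.cong[OF refl])
    fix C assume C: "C \<in> fibres (\<chi> \<circ> f) U"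
    have "inj_on f C" using inj sub[OF C] by (rule inj_on_subset)
    moreover have "nu (f u) = nu u" if "u \<in> C" for u using nu sub[OF C] that by auto
    ultimately show "gap \<alpha> (f ` C) = gap \<alpha> C"
      by (simp add: gap_def sum.reindex cong: sum.cong)
  qed
  finally show ?thesis .
qed

section \<open>Disjoint copies of a finite set\<close>

lemma msets_mono: "S \<subseteq> T \<Longrightarrow> msets h S \<subseteq> msets h T"
  by (auto simp: msets_def)

lemma is_BsetD:
  assumes "is_Bset h 1 S" "u \<in> msets h S" "v \<in> msets h S" "sum_mset u = sum_mset v"
  shows "u = v"
proof -
  let ?Z = "{w \<in> msets h S. sum_mset w = sum_mset v}"
  have "finite ?Z" "card ?Z \<le> 1" using assms(1) by (auto simp: is_Bset_def)
  then show ?thesis using assms(2-4) card_le_Suc0_iff_eq[of ?Z] by auto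
qed

lemma finite_card_le_1:
  assumes "\<And>x y. x \<in> X \<Longrightarrow> y \<in> X \<Longrightarrow> x = y"
  shows "finite X \<and> card X \<le> 1"
proof -
  have "X = {} \<or> (\<exists>x. X = {x})" using assms by blast
  then show ?thesis by auto
qed

text \<open>
  \<open>sep\<close> says that the copies are independent: distinct multisets of equal sum lie in one copy.
\<close>

locale layers =
  fixes e :: "nat \<Rightarrow> 'a::ab_group_add \<Rightarrow> 'b::ab_group_add" and F :: "'a set" and N h :: nat
  assumes finite_F: "finite F" and h_pos: "0 < h" and inj_e: "\<And>k. inj (e k)"
    and disj: "\<And>j k a b. \<lbrakk>j < N; k < N; a \<in> F; b \<in> F; e j a = e k b\<rbrakk> \<Longrightarrow> j = k"
    and sum_eq: "\<And>k u v. \<lbrakk>u \<in> msets h F; v \<in> msets h F\<rbrakk> \<Longrightarrow>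
      sum_mset (image_mset (e k) u) = sum_mset (image_mset (e k) v) \<longleftrightarrow> sum_mset u = sum_mset v"
    and sep: "\<And>u v. \<lbrakk>u \<in> msets h (\<Union>k<N. e k ` F); v \<in> msets h (\<Union>k<N. e k ` F);
        sum_mset u = sum_mset v; u \<noteq> v\<rbrakk> \<Longrightarrow>
      \<exists>k<N. u \<in> image_mset (e k) ` msets h F \<and> v \<in> image_mset (e k) ` msets h F"
begin

definition total :: "'b set" where "total = (\<Union>k<N. e k ` F)"

definition layer :: "nat \<Rightarrow> 'b multiset set" where "layer k = image_mset (e k) ` msets h F"

lemma finite_total: "finite total"
  by (simp add: total_def finite_F)

lemma card_UN_layers:
  assumes "\<And>k. k < N \<Longrightarrow> T k \<subseteq> F"
  shows "card (\<Union>k<N. e k ` T k) = (\<Sum>k<N. card (T k))"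
proof -
  have "card (\<Union>k<N. e k ` T k) = (\<Sum>k<N. card (e k ` T k))"
    using assms finite_F disj
    by (intro card_UN_disjoint) (auto intro: finite_subset, (metis subsetD)+)
  then show ?thesis
    by (simp add: card_image inj_on_subset[OF inj_e])
qed

lemma card_total: "card total = N * card F"
  unfolding total_def using card_UN_layers[of "\<lambda>_. F"] by simp

lemma layer_subset: "k < N \<Longrightarrow> layer k \<subseteq> msets h total"
  unfolding layer_def total_def msets_def by fastforce

text \<open>A member of a layer is nonempty because \<open>0 < h\<close>, and by \<open>disj\<close>
  any one of its elements identifies the copy.\<close>

lemma layer_disj:
  assumes "u \<in> layer j" "u \<in> layer k" "j < N" "k < N"
  shows "j = k"
proof -
  obtain v w where vw: "v \<in> msets h F" "w \<in> msets h F" "u = image_mset (e j) v" "u = image_mset (e k) w"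
    using assms by (auto simp: layer_def)
  have "u \<noteq> {#}" using vw(1,3) h_pos by (auto simp: msets_def)
  then obtain x where "x \<in># u" by auto
  moreover have "set_mset u \<subseteq> e j ` F" using vw(1,3) by (auto simp: msets_def)
  moreover have "set_mset u \<subseteq> e k ` F" using vw(2,4) by (auto simp: msets_def)
  ultimately have "x \<in> e j ` F" "x \<in> e k ` F" by auto
  then obtain a b where "a \<in> F" "b \<in> F" "e j a = e k b" by auto
  then show ?thesis using disj[of j k a b] assms(3,4) by simp
qed

lemma sepE:
  assumes "u \<in> msets h total" "v \<in> msets h total" "sum_mset u = sum_mset v" "u \<noteq> v"
  obtains k where "k < N" "u \<in> layer k" "v \<in> layer k"
  using sep[of u v] assms unfolding layer_def total_def by blast

lemma inj_image_mset: "inj (image_mset (e k))"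
  using inj_e by (rule multiset.inj_map)

text \<open>If some sum has two representations, \<open>sep\<close> puts them in one layer, and then
  all representations of that sum in the same layer. Pulled back along \<open>e k\<close> they
  become representations over \<open>T k\<close>, of which there are at most
  \<open>g\<close>.\<close>

lemma is_Bset_UN:
  assumes g: "1 \<le> g" and T: "\<And>k. k < N \<Longrightarrow> T k \<subseteq> F" "\<And>k. k < N \<Longrightarrow> is_Bset h g (T k)"
  shows "is_Bset h g (\<Union>k<N. e k ` T k)"
  unfolding is_Bset_def
proof (intro allI)
  fix z
  let ?S = "\<Union>k<N. e k ` T k"
  let ?Z = "{u \<in> msets h ?S. sum_mset u = z}"
  have S: "?S \<subseteq> total" using T(1) by (auto simp: total_def)
  show "finite ?Z \<and> card ?Z \<le> g"
  proof (cases "\<exists>u v. u \<in> ?Z \<and> v \<in> ?Z \<and> u \<noteq> v")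
    case False
    then have "finite ?Z \<and> card ?Z \<le> 1" by (intro finite_card_le_1) blast
    then show ?thesis using g by linarith
  next
    case True
    then obtain u v where uv: "u \<in> ?Z" "v \<in> ?Z" "u \<noteq> v" by auto
    have tot: "w \<in> msets h total" if "w \<in> ?Z" for w using msets_mono[OF S] that by auto
    obtain k where k: "k < N" "u \<in> layer k" "v \<in> layer k"
      using sepE[of u v] uv tot by auto
    \<comment> \<open>Each \<open>w\<close> other than \<open>u\<close> shares some layer with
      \<open>u\<close>, and \<open>u\<close> lies in layer \<open>k\<close> only.\<close>
    have in_layer: "w \<in> layer k" if w: "w \<in> ?Z" for w
    proof (cases "w = u")
      case False
      then obtain j where "j < N" "w \<in> layer j" "u \<in> layer j"
        using sepE[of w u] w uv(1) tot by auto
      then show ?thesis using layer_disj k by auto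
    qed (use k in simp)
    obtain u' where u': "u' \<in> msets h F" "u = image_mset (e k) u'" using k by (auto simp: layer_def)
    let ?Y = "{w \<in> msets h (T k). sum_mset w = sum_mset u'}"
    have "?Z \<subseteq> image_mset (e k) ` ?Y"
    proof
      fix w assume w: "w \<in> ?Z"
      obtain w' where w': "w' \<in> msets h F" "w = image_mset (e k) w'"
        using in_layer[OF w] by (auto simp: layer_def)
      \<comment> \<open>A priori \<open>e k a\<close> could come from another copy
        \<open>T j\<close>; \<open>disj\<close> excludes this.\<close>
      have "a \<in> T k" if a: "a \<in># w'" for a
      proof -
        have aF: "a \<in> F" using w'(1) a by (auto simp: msets_def)
        have "set_mset w \<subseteq> ?S" "e k a \<in># w" using w w'(2) a by (auto simp: msets_def)
        then have "e k a \<in> ?S" by blast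
        then obtain j b where jb: "j < N" "b \<in> T j" "e k a = e j b" by auto
        then have "k = j" using disj[of k j a b] k(1) aF T(1)[OF jb(1)] by auto
        then show ?thesis using jb inj_e by (auto dest: injD)
      qed
      then have "w' \<in> msets h (T k)" using w'(1) by (auto simp: msets_def)
      moreover have "sum_mset w' = sum_mset u'"
        using sum_eq[OF w'(1) u'(1), of k] w uv(1) w'(2) u'(2) by auto
      ultimately show "w \<in> image_mset (e k) ` ?Y" using w'(2) by auto
    qed
    moreover have "finite ?Y" "card ?Y \<le> g" using T(2)[OF k(1)] by (auto simp: is_Bset_def)
    ultimately show ?thesis
      by (meson card_image_le card_mono finite_imageI finite_subset le_trans)
  qed
qed

text \<open>The injective map \<open>image_mset (e k)\<close> sends representations of one sum over
  the trace to representations of one sum over \<open>S\<close>.\<close>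

lemma is_Bset_layer:
  assumes "S \<subseteq> total" "is_Bset h g S"
  shows "is_Bset h g {a \<in> F. e k a \<in> S}"
  unfolding is_Bset_def
proof (intro allI)
  fix z
  let ?T = "{a \<in> F. e k a \<in> S}"
  let ?Y = "{w \<in> msets h ?T. sum_mset w = z}"
  show "finite ?Y \<and> card ?Y \<le> g"
  proof (cases "?Y = {}")
    case False
    then obtain u where u: "u \<in> ?Y" by auto
    let ?Z = "{w \<in> msets h S. sum_mset w = sum_mset (image_mset (e k) u)}"
    have F: "w \<in> msets h F" if "w \<in> ?Y" for w using that by (auto simp: msets_def)
    have "image_mset (e k) w \<in> ?Z" if "w \<in> ?Y" for w
      using that u sum_eq[OF F[OF that] F[OF u], of k] by (auto simp: msets_def)
    then have "image_mset (e k) ` ?Y \<subseteq> ?Z" by blast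
    moreover have "finite ?Z" "card ?Z \<le> g" using assms(2) by (auto simp: is_Bset_def)
    moreover have "inj_on (image_mset (e k)) ?Y"
      using inj_image_mset by (rule inj_on_subset) simp
    ultimately show ?thesis
      by (meson card_inj_on_le finite_subset finite_imageD le_trans)
  next
    case True
    then show ?thesis by (metis card.empty finite.emptyI le0)
  qed
qed

text \<open>For the upper bound, an extremal set is cut into its traces on the \<open>N\<close>
  copies. For the lower bound, one extremal subset of \<open>F\<close> is repeated in every
  copy.\<close>

lemma bmax_total:
  assumes "1 \<le> g"
  shows "bmax h g total = N * bmax h g F"
proof (rule antisym)
  obtain S where S: "S \<subseteq> total" "is_Bset h g S" "card S = bmax h g total"
    using bmax_attained[OF finite_total assms] by blast
  have "S = (\<Union>k<N. e k ` {a \<in> F. e k a \<in> S})"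
    using S(1) unfolding total_def by blast
  then have "card S = (\<Sum>k<N. card {a \<in> F. e k a \<in> S})"
    using card_UN_layers[of "\<lambda>k. {a \<in> F. e k a \<in> S}"] by simp
  also have "\<dots> \<le> (\<Sum>k<N. bmax h g F)"
    using is_Bset_layer[OF S(1,2)] by (intro sum_mono bmax_ge finite_F) auto
  finally show "bmax h g total \<le> N * bmax h g F" using S(3) by simp
next
  obtain T where T: "T \<subseteq> F" "is_Bset h g T" "card T = bmax h g F"
    using bmax_attained[OF finite_F assms] by blast
  have "card (\<Union>k<N. e k ` T) \<le> bmax h g total"
    using is_Bset_UN[OF assms, of "\<lambda>_. T"] T
    by (intro bmax_ge finite_total) (auto simp: total_def)
  then show "N * bmax h g F \<le> bmax h g total"
    using card_UN_layers[of "\<lambda>_. T"] T by simp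
qed

text \<open>A multiset outside all layers shares its sum with no other multiset, so such multisets
  contribute nothing. Distinct layers have no sum in common, so their defects add up.\<close>

lemma defect_total:
  "defect \<alpha> \<chi> (msets h total) = (\<Sum>k<N. defect \<alpha> (\<chi> \<circ> image_mset (e k)) (msets h F))"
proof -
  let ?L = "\<Union>k<N. layer k"
  let ?M = "msets h total - ?L"
  have fin: "finite (msets h total)" by (rule finite_msets[OF finite_total])
  have L: "?L \<subseteq> msets h total" using layer_subset by auto
  have "inj_on sum_mset ?M"
  proof (rule inj_onI, rule ccontr)
    fix u v assume "u \<in> ?M" "v \<in> ?M" "sum_mset u = sum_mset v" "u \<noteq> v"
    then show False by (auto elim: sepE[of u v])
  qed
  then have M: "defect \<alpha> \<chi> ?M = 0" by (rule defect_inj)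
  have "sum_mset ` ?L \<inter> sum_mset ` ?M = {}"
  proof -
    have "sum_mset u \<noteq> sum_mset v" if uv: "u \<in> ?L" "v \<in> ?M" for u v
    proof
      assume eq: "sum_mset u = sum_mset v"
      have "u \<in> msets h total" "v \<in> msets h total" "u \<noteq> v" using uv L by auto
      then obtain k where "k < N" "v \<in> layer k" using sepE[OF _ _ eq] by metis
      then show False using uv by auto
    qed
    then show ?thesis by (auto simp only: disjoint_iff image_iff)
  qed
  then have "defect \<alpha> \<chi> (?L \<union> ?M) = defect \<alpha> \<chi> ?L + defect \<alpha> \<chi> ?M"
    using finite_subset[OF L fin] fin by (intro defect_union) (simp_all only: finite_Diff)
  moreover have "?L \<union> ?M = msets h total" using L by blast
  moreover have "defect \<alpha> \<chi> ?L = (\<Sum>k<N. defect \<alpha> \<chi> (layer k))"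
  proof (rule defect_UN)
    show "sum_mset ` layer i \<inter> sum_mset ` layer j = {}" if ij: "i \<in> {..<N}" "j \<in> {..<N}" "i \<noteq> j" for i j
    proof -
      have "sum_mset u \<noteq> sum_mset v" if uv: "u \<in> layer i" "v \<in> layer j" for u v
      proof
        assume eq: "sum_mset u = sum_mset v"
        have N: "i < N" "j < N" using ij by auto
        then have "u \<noteq> v" using layer_disj[of u i j] uv ij by auto
        moreover have "u \<in> msets h total" "v \<in> msets h total"
          using layer_subset[OF N(1)] layer_subset[OF N(2)] uv by auto
        ultimately obtain k where k: "k < N" "u \<in> layer k" "v \<in> layer k"
          using sepE[OF _ _ eq] by metis
        then show False
          using layer_disj[of u i k] layer_disj[of v j k] uv ij(3) N by simp
      qed
      then show ?thesis by (auto simp only: disjoint_iff image_iff)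
    qed
  qed (use finite_msets[OF finite_F] in \<open>auto simp: layer_def\<close>)
  moreover have "defect \<alpha> \<chi> (layer k) = defect \<alpha> (\<chi> \<circ> image_mset (e k)) (msets h F)" for k
    unfolding layer_def using inj_on_subset[OF inj_image_mset] nu_image_mset[OF inj_e] sum_eq
    by (intro defect_image) auto
  ultimately show ?thesis using M by simp
qed

text \<open>An optimal colouring of the union induces a colouring of \<open>F\<close> through each
  layer, which gives one inequality. Copying an optimal colouring of \<open>F\<close> into every
  layer gives the other.\<close>

lemma rdef_total:
  assumes "0 \<le> \<alpha>" "\<alpha> \<le> 1" "1 \<le> g"
  shows "rdef \<alpha> h g total = real N * rdef \<alpha> h g F"
proof (rule antisym)
  obtain \<chi> where \<chi>: "\<chi> \<in> msets h total \<rightarrow> {1..g}" "rdef \<alpha> h g total = defect \<alpha> \<chi> (msets h total)"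
    using rdef_attained[OF finite_total assms] by blast
  have "rdef \<alpha> h g F \<le> defect \<alpha> (\<chi> \<circ> image_mset (e k)) (msets h F)" if "k < N" for k
    using \<chi>(1) layer_subset[OF that]
    by (intro rdef_le_defect[OF finite_F assms(1,2)]) (auto simp: layer_def Pi_iff)
  then have "(\<Sum>k<N. rdef \<alpha> h g F) \<le> (\<Sum>k<N. defect \<alpha> (\<chi> \<circ> image_mset (e k)) (msets h F))"
    by (intro sum_mono) auto
  then show "real N * rdef \<alpha> h g F \<le> rdef \<alpha> h g total"
    using \<chi>(2) defect_total by simp
next
  obtain \<chi> where \<chi>: "\<chi> \<in> msets h F \<rightarrow> {1..g}" "rdef \<alpha> h g F = defect \<alpha> \<chi> (msets h F)"
    using rdef_attained[OF finite_F assms] by blast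
  \<comment> \<open>The choice operator recovers the preimage in \<open>msets h F\<close>, which is
    unique by \<open>layer_disj\<close> and injectivity. The colour 1 outside the layers is
    arbitrary and admissible because \<open>1 \<le> g\<close>.\<close>
  define \<chi>' where "\<chi>' u = (if \<exists>k<N. u \<in> layer k
    then \<chi> (SOME w. w \<in> msets h F \<and> (\<exists>k<N. u = image_mset (e k) w)) else 1)" for u
  have \<chi>': "\<chi>' (image_mset (e k) w) = \<chi> w" if kw: "k < N" "w \<in> msets h F" for k w
  proof -
    have "(SOME w'. w' \<in> msets h F \<and> (\<exists>j<N. image_mset (e k) w = image_mset (e j) w')) = w"
    proof (rule some_equality)
      fix w' assume "w' \<in> msets h F \<and> (\<exists>j<N. image_mset (e k) w = image_mset (e j) w')"
      then obtain j where j: "w' \<in> msets h F" "j < N" "image_mset (e k) w = image_mset (e j) w'"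
        by auto
      have "image_mset (e k) w \<in> layer j" using j(1,3) by (simp add: layer_def)
      moreover have "image_mset (e k) w \<in> layer k" using kw by (simp add: layer_def)
      ultimately have "j = k" using layer_disj j(2) kw(1) by blast
      then show "w' = w" using j(3) injD[OF inj_image_mset] by metis
    qed (use kw in auto)
    moreover have "\<exists>j<N. image_mset (e k) w \<in> layer j" using kw by (auto simp: layer_def)
    ultimately show ?thesis by (simp add: \<chi>'_def)
  qed
  have "\<chi>' u \<in> {1..g}" for u
  proof (cases "\<exists>k<N. u \<in> layer k")
    case True
    then obtain k w where "k < N" "w \<in> msets h F" "u = image_mset (e k) w" by (auto simp: layer_def)
    then show ?thesis using \<chi>' \<chi>(1) by (auto simp: Pi_iff)
  next
    case False
    then have "\<chi>' u = 1" unfolding \<chi>'_def by (rule if_not_P)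
    then show ?thesis using assms(3) by simp
  qed
  then have "rdef \<alpha> h g total \<le> defect \<alpha> \<chi>' (msets h total)"
    by (intro rdef_le_defect[OF finite_total assms(1,2)]) auto
  also have "\<dots> = (\<Sum>k<N. defect \<alpha> \<chi> (msets h F))"
    unfolding defect_total using \<chi>' by (intro sum.cong defect_cong) auto
  finally show "rdef \<alpha> h g total \<le> real N * rdef \<alpha> h g F" using \<chi>(2) by simp
qed

end

section \<open>Dilates and base B digits\<close>

text \<open>Padding both multisets with \<open>k - m\<close> copies of a fixed element of
  \<open>S\<close> brings them to size \<open>k\<close> and keeps their sums equal.\<close>

lemma is_Bset_smaller:
  fixes S :: "'a::ab_group_add set"
  assumes "is_Bset k 1 S" "m \<le> k" "u \<in> msets m S" "v \<in> msets m S" "sum_mset u = sum_mset v"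
  shows "u = v"
proof (cases "S = {}")
  case True
  then show ?thesis using assms(3,4) by (auto simp: msets_def)
next
  case False
  then obtain x where x: "x \<in> S" by auto
  let ?r = "replicate_mset (k - m) x"
  have "set_mset ?r \<subseteq> S" using x by (auto simp: set_mset_replicate_mset_subset)
  then have "u + ?r \<in> msets k S" "v + ?r \<in> msets k S"
    using assms(2-4) by (auto simp: msets_def)
  then have "u + ?r = v + ?r"
    using assms(5) by (intro is_BsetD[OF assms(1)]) simp_all
  then show ?thesis by simp
qed

text \<open>Reduction modulo \<open>B\<close> isolates the lowest digit; after cancelling it and
  dividing by \<open>B\<close> the induction continues with shifted digits.\<close>

lemma digits_unique:
  fixes B :: int
  assumes "\<And>j. j < n \<Longrightarrow> 0 \<le> c j \<and> c j < B" "\<And>j. j < n \<Longrightarrow> 0 \<le> d j \<and> d j < B"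
    and "(\<Sum>j<n. c j * B ^ j) = (\<Sum>j<n. d j * B ^ j)" "j < n"
  shows "c j = d j"
  using assms
proof (induction n arbitrary: c d j)
  case (Suc n)
  have split: "(\<Sum>j<Suc n. f j * B ^ j) = f 0 + B * (\<Sum>j<n. f (Suc j) * B ^ j)" for f :: "nat \<Rightarrow> int"
    unfolding sum.lessThan_Suc_shift sum_distrib_left by (simp add: mult_ac)
  have eq: "c 0 + B * (\<Sum>j<n. c (Suc j) * B ^ j) = d 0 + B * (\<Sum>j<n. d (Suc j) * B ^ j)"
    using Suc.prems(3) unfolding split .
  have b: "0 \<le> c 0" "c 0 < B" "0 \<le> d 0" "d 0 < B"
    using Suc.prems(1)[of 0] Suc.prems(2)[of 0] by auto
  have "c 0 = (c 0 + B * (\<Sum>j<n. c (Suc j) * B ^ j)) mod B" using b by simp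
  also have "\<dots> = d 0" unfolding eq using b by simp
  finally have c0: "c 0 = d 0" .
  have rest: "(\<Sum>j<n. c (Suc j) * B ^ j) = (\<Sum>j<n. d (Suc j) * B ^ j)"
    using eq c0 b by simp
  show ?case
  proof (cases j)
    case (Suc i)
    then show ?thesis
      using Suc.IH[of "\<lambda>j. c (Suc j)" "\<lambda>j. d (Suc j)" i] Suc.prems rest by simp
  qed (simp add: c0)
qed simp

section \<open>Labelled multisets and their digit expansions\<close>

lemma sum_lessThan_add:
  fixes f :: "nat \<Rightarrow> 'a::comm_monoid_add"
  shows "(\<Sum>j<m + n. f j) = (\<Sum>j<m. f j) + (\<Sum>j<n. f (m + j))"
  by (induction n) (simp_all add: add.assoc)

lemma multisets_of_imageE:
  assumes "set_mset u \<subseteq> f ` S"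
  obtains w where "set_mset w \<subseteq> S" "u = image_mset f w"
proof -
  have "\<exists>w. set_mset w \<subseteq> S \<and> u = image_mset f w"
    using assms
  proof (induction u)
    case (add x u)
    then obtain w a where "set_mset w \<subseteq> S" "u = image_mset f w" "a \<in> S" "x = f a" by auto
    then show ?case by (intro exI[of _ "add_mset a w"]) auto
  qed simp
  then show ?thesis using that by blast
qed

text \<open>The first summand stores \<open>a\<close> at position \<open>k\<close>; the second adds
  1 at position \<open>N + k\<close>, which counts the elements taken from layer
  \<open>k\<close>.\<close>

definition dil :: "int \<Rightarrow> nat \<Rightarrow> nat \<Rightarrow> int \<Rightarrow> int" where
  "dil B N k a = a * B ^ k + B ^ (N + k)"

text \<open>Multisets over the union of the layers are lifted to multisets of pairs consisting of a
  layer index and an element of \<open>F\<close>, so that the layer of each element is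
  explicit.\<close>

definition part :: "nat \<Rightarrow> (nat \<times> 'a) multiset \<Rightarrow> 'a multiset" where
  "part k w = image_mset snd (filter_mset (\<lambda>p. fst p = k) w)"

lemma count_part: "count (part k w) a = count w (k, a)"
  by (induction w) (auto simp: part_def)

lemma eq_if_parts_eq:
  fixes v w :: "(nat \<times> 'a) multiset"
  assumes "set_mset v \<subseteq> {..<N} \<times> S" "set_mset w \<subseteq> {..<N} \<times> S" "\<And>k. k < N \<Longrightarrow> part k v = part k w"
  shows "v = w"
proof (rule multiset_eqI)
  fix p :: "nat \<times> 'a"
  obtain k a where p: "p = (k, a)" by (cases p)
  show "count v p = count w p"
  proof (cases "k < N")
    case True
    then show ?thesis using assms(3) p by (metis count_part)
  next
    case False
    then have "p \<notin># v" "p \<notin># w" using assms(1,2) p by auto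
    then show ?thesis by (simp add: not_in_iff)
  qed
qed

lemma set_part: "set_mset w \<subseteq> {..<N} \<times> S \<Longrightarrow> set_mset (part k w) \<subseteq> S"
  by (auto simp: part_def)

lemma size_part_le: "size (part k w) \<le> size w"
  by (simp add: part_def size_filter_mset_lesseq)

text \<open>A filter that keeps the size keeps the whole multiset, so every label equals
  \<open>k\<close>.\<close>

lemma full_part:
  assumes "size (part k w) = size w"
  shows "w = image_mset (Pair k) (part k w)"
proof -
  have "\<not> filter_mset (\<lambda>p. fst p = k) w \<subset># w"
    using assms mset_subset_size by (fastforce simp: part_def)
  then have w: "filter_mset (\<lambda>p. fst p = k) w = w"
    by (simp add: subset_mset.less_le)
  then have "image_mset (\<lambda>p. (k, snd p)) w = image_mset (\<lambda>p. p) w"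
    by (intro image_mset_cong) (auto simp: filter_mset_eq_conv)
  then show ?thesis by (simp add: part_def w multiset.map_comp comp_def)
qed

text \<open>Each pair adds to one lower and one upper coefficient. That the coefficients are genuine
  digits below \<open>B\<close> is shown only in \<open>parts_determined\<close>.\<close>

lemma sum_dil_eq:
  assumes "set_mset w \<subseteq> {..<N} \<times> S"
  shows "sum_mset (image_mset (\<lambda>(k, a). dil B N k a) w)
    = (\<Sum>j<N + N. (if j < N then sum_mset (part j w) else int (size (part (j - N) w))) * B ^ j)"
proof -
  have "sum_mset (image_mset (\<lambda>(k, a). dil B N k a) w)
    = (\<Sum>j<N. sum_mset (part j w) * B ^ j) + (\<Sum>j<N. int (size (part j w)) * B ^ (N + j))"
    using assms
  proof (induction w)
    case (add p w)
    obtain k a where p: "p = (k, a)" "k < N" using add.prems by (cases p) auto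
    have "(\<Sum>j<N. sum_mset (part j (add_mset p w)) * B ^ j)
      = (\<Sum>j<N. sum_mset (part j w) * B ^ j + (if j = k then a * B ^ k else 0))"
      by (intro sum.cong) (auto simp: part_def p algebra_simps)
    moreover have "(\<Sum>j<N. int (size (part j (add_mset p w))) * B ^ (N + j))
      = (\<Sum>j<N. int (size (part j w)) * B ^ (N + j) + (if j = k then B ^ (N + k) else 0))"
      by (intro sum.cong) (auto simp: part_def p algebra_simps)
    ultimately show ?case
      using add p by (simp add: sum.distrib dil_def)
  qed (simp add: part_def)
  then show ?thesis by (simp add: sum_lessThan_add)
qed

lemma sum_mset_bounds:
  assumes "set_mset u \<subseteq> {1..M :: int}"
  shows "0 \<le> sum_mset u" "sum_mset u \<le> int (size u) * M"
proof -
  have "0 \<le> sum_mset u \<and> sum_mset u \<le> int (size u) * M"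
    using assms by (induction u) (auto simp: algebra_simps)
  then show "0 \<le> sum_mset u" "sum_mset u \<le> int (size u) * M" by auto
qed

text \<open>Sums of parts and sizes of parts all lie between 0 and \<open>h * M\<close>, hence below
  \<open>B\<close>, so no carries occur and \<open>digits_unique\<close> compares them position by
  position.\<close>

lemma parts_determined:
  assumes F: "F \<subseteq> {1..M}" and B: "int h * M < B" and M: "1 \<le> M"
    and w: "set_mset w \<subseteq> {..<N} \<times> F" "size w \<le> h"
    and w': "set_mset w' \<subseteq> {..<N} \<times> F" "size w' \<le> h"
    and eq: "sum_mset (image_mset (\<lambda>(k, a). dil B N k a) w) = sum_mset (image_mset (\<lambda>(k, a). dil B N k a) w')"
    and k: "k < N"
  shows "sum_mset (part k w) = sum_mset (part k w')" "size (part k w) = size (part k w')"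
proof -
  define D where "D w j = (if j < N then sum_mset (part j w) else int (size (part (j - N) w)))"
    for w :: "(nat \<times> int) multiset" and j
  have bound: "0 \<le> D w j \<and> D w j < B" if "set_mset w \<subseteq> {..<N} \<times> F" "size w \<le> h" for w j
  proof -
    have sz: "size (part i w) \<le> h" for i using size_part_le[of i w] that(2) by simp
    have "set_mset (part j w) \<subseteq> {1..M}" using set_part[OF that(1)] F by blast
    note this[THEN sum_mset_bounds(1)] this[THEN sum_mset_bounds(2)]
    moreover have "int (size (part j w)) * M \<le> int h * M"
      using sz[of j] M by (intro mult_right_mono) auto
    \<comment> \<open>The upper coefficients are counts of at most \<open>h\<close>;
      \<open>1 \<le> M\<close> brings them under the same bound as the sums.\<close>
    moreover have "int h \<le> int h * M" using M mult_left_mono[of 1 M "int h"] by simp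
    moreover have "int (size (part (j - N) w)) \<le> int h" using sz by simp
    ultimately show ?thesis using B unfolding D_def by auto
  qed
  have "(\<Sum>j<N + N. D w j * B ^ j) = (\<Sum>j<N + N. D w' j * B ^ j)"
    using eq unfolding sum_dil_eq[OF w(1)] sum_dil_eq[OF w'(1)] D_def .
  then have D: "D w j = D w' j" if "j < N + N" for j
    using digits_unique[of "N + N" "D w" B "D w'" j] bound w w' that by blast
  show "sum_mset (part k w) = sum_mset (part k w')"
    using D[of k] k by (simp add: D_def)
  show "size (part k w) = size (part k w')"
    using D[of "N + k"] k by (simp add: D_def)
qed

lemma layers_dil:
  fixes F :: "int set"
  assumes "finite F" "F \<noteq> {}" "0 < h" "is_Bset (h - 1) 1 F" "F \<subseteq> {1..M}" "int h * M < B"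
  shows "layers (dil B N) F N h"
proof
  have M: "1 \<le> M" using assms(2,5) by auto
  have B: "0 < B" using assms(6) M by (smt (verit) mult_nonneg_nonneg of_nat_0_le_iff)
  show "finite F" "0 < h" by fact+
  show "inj (dil B N k)" for k
    using B by (intro injI) (simp add: dil_def)
  show "j = k" if "j < N" "k < N" "a \<in> F" "b \<in> F" "dil B N j a = dil B N k b" for j k a b
  proof -
    \<comment> \<open>The digit argument for singletons: the left size is 1, while the right one is
      1 only for \<open>k = j\<close>.\<close>
    have "size (part j {#(j, a)#}) = size (part j {#(k, b)#})"
      using that assms(3) by (intro parts_determined(2)[OF assms(5,6) M]) auto
    then show ?thesis by (auto simp: part_def split: if_splits)
  qed
  show "sum_mset (image_mset (dil B N k) u) = sum_mset (image_mset (dil B N k) v)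
      \<longleftrightarrow> sum_mset u = sum_mset v" if "u \<in> msets h F" "v \<in> msets h F" for k u v
  proof -
    \<comment> \<open>On multisets of the common size \<open>h\<close> the second summand is
      constant, and \<open>B ^ k\<close> is nonzero.\<close>
    have "sum_mset (image_mset (dil B N k) w) = sum_mset w * B ^ k + int (size w) * B ^ (N + k)" for w
      by (induction w) (simp_all add: dil_def algebra_simps)
    then show ?thesis using that B by (simp add: msets_def)
  qed
  fix u v
  assume u: "u \<in> msets h (\<Union>k<N. dil B N k ` F)" and v: "v \<in> msets h (\<Union>k<N. dil B N k ` F)"
    and eq: "sum_mset u = sum_mset v" and ne: "u \<noteq> v"
  let ?e = "\<lambda>(k, a). dil B N k a"
  have im: "(\<Union>k<N. dil B N k ` F) = ?e ` ({..<N} \<times> F)" by auto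
  obtain w where w: "set_mset w \<subseteq> {..<N} \<times> F" "u = image_mset ?e w"
    using u im by (auto simp: msets_def elim: multisets_of_imageE)
  obtain w' where w': "set_mset w' \<subseteq> {..<N} \<times> F" "v = image_mset ?e w'"
    using v im by (auto simp: msets_def elim: multisets_of_imageE)
  have sz: "size w = h" "size w' = h" using u v w(2) w'(2) by (auto simp: msets_def)
  have parts: "sum_mset (part k w) = sum_mset (part k w')" "size (part k w) = size (part k w')"
    if "k < N" for k
    using parts_determined[OF assms(5,6) M w(1) _ w'(1) _ _ that] eq w(2) w'(2) sz by auto
  \<comment> \<open>Otherwise all parts have size at most \<open>h - 1\<close>, where the sum
    determines the part, and the two lifts would coincide.\<close>
  have "\<exists>k<N. size (part k w) = h"
  proof (rule ccontr)
    assume *: "\<not> (\<exists>k<N. size (part k w) = h)"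
    have "part k w = part k w'" if k: "k < N" for k
    proof (rule is_Bset_smaller[OF assms(4)])
      show "size (part k w) \<le> h - 1"
        using size_part_le[of k w] sz(1) * k by (cases "size (part k w) = h") auto
      show "part k w \<in> msets (size (part k w)) F" "part k w' \<in> msets (size (part k w)) F"
        using parts[OF k] set_part[OF w(1)] set_part[OF w'(1)] by (auto simp: msets_def)
    qed (rule parts(1)[OF k])
    then have "w = w'" by (rule eq_if_parts_eq[OF w(1) w'(1)])
    then show False using ne w(2) w'(2) by simp
  qed
  then obtain k where k: "k < N" "size (part k w) = h" by blast
  \<comment> \<open>Stated for a general lift \<open>y\<close> in order to serve both
    \<open>w\<close> and \<open>w'\<close>: equal part sizes make \<open>part k w'\<close> full as
    well, so \<open>u\<close> and \<open>v\<close> lie in the same layer.\<close>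
  have "x \<in> image_mset (dil B N k) ` msets h F"
    if "set_mset y \<subseteq> {..<N} \<times> F" "x = image_mset ?e y" "size (part k y) = h" "size y = h" for x y
  proof
    show "part k y \<in> msets h F" using set_part[OF that(1)] that(3) by (simp add: msets_def)
    have "y = image_mset (Pair k) (part k y)" using that(3,4) by (intro full_part) simp
    then have "x = image_mset ?e (image_mset (Pair k) (part k y))" using that(2) by simp
    then show "x = image_mset (dil B N k) (part k y)" by (simp add: multiset.map_comp comp_def)
  qed
  then show "\<exists>k<N. u \<in> image_mset (dil B N k) ` msets h F \<and> v \<in> image_mset (dil B N k) ` msets h F"
    using k w w' sz parts(2)[OF k(1)] by auto
qed

section \<open>Exact scaling and optimality of the linear dependence\<close>

lemma dilates_eq_UN: "dilates F B N = (\<Union>k<N. dil B N k ` F)"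
  by (auto simp: dilates_def dil_def)

lemma bmax_less_card:
  assumes "finite A" "1 \<le> g" "\<not> is_Bset h g A"
  shows "bmax h g A < card A"
proof -
  obtain S where S: "S \<subseteq> A" "is_Bset h g S" "card S = bmax h g A"
    using bmax_attained[OF assms(1,2)] by blast
  then have "S \<subset> A" using assms(3) by auto
  then show ?thesis using psubset_card_mono[OF assms(1)] S(3) by metis
qed

text \<open>After division by \<open>real N powr \<theta>\<close> the claim says that
  \<open>real N powr (1 - \<theta>)\<close> exceeds a constant, which holds for large
  \<open>N\<close> since \<open>1 - \<theta>\<close> is positive.\<close>

lemma linear_beats_powr:
  fixes a r C \<theta> :: real
  assumes "0 < a" "0 < r" "\<theta> < 1"
  obtains N :: nat where "1 \<le> N" "C * (r * real N) powr \<theta> < a * real N"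
proof -
  \<comment> \<open>The absolute value and the added 1 keep \<open>K\<close> positive for either
    sign of \<open>C\<close> and strictly above the constant to be beaten.\<close>
  define K where "K = \<bar>C * r powr \<theta> / a\<bar> + 1"
  define N where "N = nat \<lceil>K powr (1 / (1 - \<theta>))\<rceil> + 1"
  have K: "0 < K" "C * r powr \<theta> / a < K" unfolding K_def by linarith+
  have N: "1 \<le> N" "K powr (1 / (1 - \<theta>)) \<le> real N"
    unfolding N_def by (simp, linarith)
  have "K = (K powr (1 / (1 - \<theta>))) powr (1 - \<theta>)"
    using K assms(3) by (simp add: powr_powr)
  also have "\<dots> \<le> real N powr (1 - \<theta>)"
    using N assms(3) by (intro powr_mono2) auto
  finally have "C * r powr \<theta> / a < real N powr (1 - \<theta>)" using K(2) by linarith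
  then have "C * r powr \<theta> < a * real N powr (1 - \<theta>)"
    using assms(1) by (simp add: field_simps)
  then have "C * r powr \<theta> * real N powr \<theta> < a * real N powr (1 - \<theta>) * real N powr \<theta>"
    using N(1) by (intro mult_strict_right_mono) auto
  also have "\<dots> = a * real N"
    using N(1) by (simp add: mult.assoc flip: powr_add)
  finally have "C * (r * real N) powr \<theta> < a * real N"
    using assms(2) by (simp add: powr_mult mult.assoc)
  then show ?thesis using that N(1) by blast
qed

theorem proposition7p3:
  fixes h g :: nat and F :: "int set"
  assumes "h \<ge> 2" and "g \<ge> 1"
    and "finite F"
    and "is_Bset (h - 1) 1 F"
    and "\<not> is_Bset h g F"
  shows
    "(\<forall>M B :: int. \<forall>N :: nat. F \<subseteq> {1..M} \<and> B > int h * M \<and> N \<ge> 1 \<longrightarrow>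
        card (dilates F B N) = card F * N
      \<and> real (card (dilates F B N)) - real (bmax h g (dilates F B N))
          = (1 - real (bmax h g F) / real (card F)) * real (card (dilates F B N))
      \<and> rdef (1 / real h) h g (dilates F B N)
          = rdef (1 / real h) h g F / real (card F) * real (card (dilates F B N)))
   \<and> (\<exists>c1 > 0. \<exists>c2 > 0. \<exists>c3 > 0. \<exists>c4 > 0.
        \<forall>M B :: int. \<forall>N :: nat. F \<subseteq> {1..M} \<and> B > int h * M \<and> N \<ge> 1 \<longrightarrow>
          c1 * real (card (dilates F B N))
            \<le> real (card (dilates F B N)) - real (bmax h g (dilates F B N))
        \<and> real (card (dilates F B N)) - real (bmax h g (dilates F B N))
            \<le> c2 * real (card (dilates F B N))
        \<and> c3 * real (card (dilates F B N))
            \<le> rdef (1 / real h) h g (dilates F B N) / (2 - 2 powr (1 / real h))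
        \<and> rdef (1 / real h) h g (dilates F B N) / (2 - 2 powr (1 / real h))
            \<le> c4 * real (card (dilates F B N)))
   \<and> (\<forall>A :: 'a::ab_group_add set. finite A \<longrightarrow>
        real (card A) - real (bmax h g A)
          \<le> rdef (1 / real h) h g A / (2 - 2 powr (1 / real h)))
   \<and> (\<forall>M B :: int. F \<subseteq> {1..M} \<and> B > int h * M \<longrightarrow>
        (\<forall>\<theta> < 1. \<forall>C :: real. \<exists>N \<ge> 1.
          real (card (dilates F B N)) - real (bmax h g (dilates F B N))
            > C * rdef (1 / real h) h g (dilates F B N) powr \<theta>))"
proof -
  define \<alpha> where "\<alpha> = 1 / real h"
  have \<alpha>: "0 \<le> \<alpha>" "\<alpha> < 1" "\<alpha> \<le> 1" using assms(1) by (auto simp: \<alpha>_def)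
  have h: "0 < h" using assms(1) by simp
  define f where "f = real (card F)"
  define b where "b = real (bmax h g F)"
  define r where "r = rdef \<alpha> h g F"
  define t where "t = 2 - 2 powr \<alpha>"
  have t: "0 < t" using two_powr_less_2[OF \<alpha>(2)] by (simp add: t_def)
  have bf: "b < f" using bmax_less_card[OF assms(3,2,5)] by (simp add: b_def f_def)
  have f: "0 < f" using bf by (simp add: b_def)
  have F: "F \<noteq> {}" using f by (auto simp: f_def)
  \<comment> \<open>The general inequality applied to \<open>F\<close> itself: as \<open>F\<close>
    is not a \<open>B_h[g]\<close> set, \<open>b < f\<close>, and this forces \<open>r\<close> to be
    positive.\<close>
  have "f - b \<le> r / t"
    using card_minus_bmax_le_rdef[OF assms(3) \<alpha>(1,2) h assms(2)] by (simp add: f_def b_def r_def t_def)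
  then have "0 < r / t" using bf by linarith
  then have r: "0 < r" using t by (simp add: zero_less_divide_iff)
  have N: "card (dilates F B N) = card F * N" "bmax h g (dilates F B N) = N * bmax h g F"
    "rdef \<alpha> h g (dilates F B N) = real N * r"
    if "F \<subseteq> {1..M}" "B > int h * M" for M B N
  proof -
    interpret layers "dil B N" F N h
      using layers_dil[OF assms(3) F h assms(4) that] .
    have "total = dilates F B N" by (simp add: total_def dilates_eq_UN)
    then show "card (dilates F B N) = card F * N" "bmax h g (dilates F B N) = N * bmax h g F"
      "rdef \<alpha> h g (dilates F B N) = real N * r"
      using card_total bmax_total[OF assms(2)] rdef_total[OF \<alpha>(1,3) assms(2)] by (auto simp: r_def)
  qed
  have N': "real (card (dilates F B N)) = f * real N"
    "real (card (dilates F B N)) - real (bmax h g (dilates F B N)) = (f - b) * real N"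
    if "F \<subseteq> {1..M} \<and> B > int h * M \<and> N \<ge> 1" for M B N
    using that N(1,2)[of M B N] by (auto simp: f_def b_def algebra_simps)
  show ?thesis
    unfolding \<alpha>_def[symmetric] f_def[symmetric] b_def[symmetric] r_def[symmetric] t_def[symmetric]
  proof (intro conjI)
    show "\<forall>M B N. F \<subseteq> {1..M} \<and> B > int h * M \<and> N \<ge> 1 \<longrightarrow>
        card (dilates F B N) = card F * N
      \<and> real (card (dilates F B N)) - real (bmax h g (dilates F B N))
          = (1 - b / f) * real (card (dilates F B N))
      \<and> rdef \<alpha> h g (dilates F B N) = r / f * real (card (dilates F B N))"
    proof (intro allI impI)
      fix M B :: int and N :: nat
      assume *: "F \<subseteq> {1..M} \<and> B > int h * M \<and> N \<ge> 1"
      show "card (dilates F B N) = card F * N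
        \<and> real (card (dilates F B N)) - real (bmax h g (dilates F B N))
          = (1 - b / f) * real (card (dilates F B N))
        \<and> rdef \<alpha> h g (dilates F B N) = r / f * real (card (dilates F B N))"
        unfolding N'(2)[OF *] unfolding N'(1)[OF *] using N(1,3)[of M B N] * f by (simp add: field_simps)
    qed
    show "\<exists>c1>0. \<exists>c2>0. \<exists>c3>0. \<exists>c4>0. \<forall>M B N. F \<subseteq> {1..M} \<and> B > int h * M \<and> N \<ge> 1 \<longrightarrow>
          c1 * real (card (dilates F B N))
            \<le> real (card (dilates F B N)) - real (bmax h g (dilates F B N))
        \<and> real (card (dilates F B N)) - real (bmax h g (dilates F B N))
            \<le> c2 * real (card (dilates F B N))
        \<and> c3 * real (card (dilates F B N)) \<le> rdef \<alpha> h g (dilates F B N) / t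
        \<and> rdef \<alpha> h g (dilates F B N) / t \<le> c4 * real (card (dilates F B N))"
    proof -
      \<comment> \<open>Both quantities are exact multiples of the cardinality, so the lower and
        upper constants may coincide. They depend on \<open>h\<close>, \<open>g\<close> and
        \<open>F\<close>, but not on \<open>M\<close>, \<open>B\<close> or \<open>N\<close>.\<close>
      have c: "0 < (f - b) / f" "0 < r / (f * t)" using bf f r t by auto
      have main: "(f - b) / f * real (card (dilates F B N))
            \<le> real (card (dilates F B N)) - real (bmax h g (dilates F B N))
        \<and> real (card (dilates F B N)) - real (bmax h g (dilates F B N))
            \<le> (f - b) / f * real (card (dilates F B N))
        \<and> r / (f * t) * real (card (dilates F B N)) \<le> rdef \<alpha> h g (dilates F B N) / t
        \<and> rdef \<alpha> h g (dilates F B N) / t \<le> r / (f * t) * real (card (dilates F B N))"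
        if *: "F \<subseteq> {1..M} \<and> B > int h * M \<and> N \<ge> 1" for M B N
        unfolding N'(2)[OF *] unfolding N'(1)[OF *] using N(3)[of M B N] * f by (simp add: field_simps)
      show ?thesis
        by (rule exI[of _ "(f - b) / f"], rule conjI[OF c(1)], rule exI[of _ "(f - b) / f"],
            rule conjI[OF c(1)], rule exI[of _ "r / (f * t)"], rule conjI[OF c(2)],
            rule exI[of _ "r / (f * t)"], rule conjI[OF c(2)]) (intro allI impI main)
    qed
    show "\<forall>A :: 'a set. finite A \<longrightarrow> real (card A) - real (bmax h g A) \<le> rdef \<alpha> h g A / t"
      unfolding t_def using card_minus_bmax_le_rdef[OF _ \<alpha>(1,2) h assms(2)] by blast
    show "\<forall>M B. F \<subseteq> {1..M} \<and> B > int h * M \<longrightarrow> (\<forall>\<theta><1. \<forall>C. \<exists>N\<ge>1.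
        real (card (dilates F B N)) - real (bmax h g (dilates F B N))
          > C * rdef \<alpha> h g (dilates F B N) powr \<theta>)"
    proof (intro allI impI)
      fix M B :: int and \<theta> C :: real
      assume *: "F \<subseteq> {1..M} \<and> B > int h * M" "\<theta> < 1"
      obtain n :: nat where n: "1 \<le> n" "C * (r * real n) powr \<theta> < (f - b) * real n"
        using linear_beats_powr[of "f - b" r \<theta> C] bf r *(2) by auto
      moreover have "rdef \<alpha> h g (dilates F B n) = r * real n" using N(3)[of M B n] *(1) by simp
      ultimately show "\<exists>N\<ge>1. C * rdef \<alpha> h g (dilates F B N) powr \<theta>
          < real (card (dilates F B N)) - real (bmax h g (dilates F B N))"
        using N'(2)[of M B n] *(1) by auto
    qed
  qed
qed

end
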